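(* For each $d=1,2,\ldots,m$, the set $\Omega_d=\{x\in\mathcal H:\sum_{c\in\mathcal I}|\mathcal F(x_c\cdot e^{\mathrm j\phi_d})|^2=r_d\}$ is prox-regular at every point $\hat x\in\Omega_d$ for which $\mathcal G_d(\hat x)$ is nonzero everywhere (in every entry).
   Context: Let $n,m\ge1$ be integers. Products, absolute values, squares, square roots, exponentials and equalities of $n\times n$ arrays are elementwise; $\mathrm j=\sqrt{-1}$; indices are $\xi=(\xi_1,\xi_2)$, $1\le\xi_1,\xi_2\le n$, and $w[\xi]$ is the entry of $w$ at $\xi$. Let $\mathcal I=\{XX,XY,XZ,YX,YY,YZ\}$ and $\mathcal H=(\mathbb C^{n\times n})^6$, with elements $x=(x_c)_{c\in\mathcal I}$, with Frobenius norm $\|x\|^2=\sum_{c\in\mathcal I}\sum_\xi|x_c[\xi]|^2$. For $\Omega\subset\mathcal H$, $P_\Omega(x)=\{w\in\Omega:\|x-w\|=\inf_{v\in\Omega}\|x-v\|\}$. $\mathcal F$ is the (unitary) two-dimensional discrete Fourier transform on $\mathbb C^{n\times n}$. For $d=1,\dots,m$, $\phi_d\in\mathbb R^{n\times n}$ and $r_d\in\mathbb R_+^{n\times n}$ (entrywise nonnegative) are given, and $\mathcal G_d(x)=\sqrt{\sum_{c\in\mathcal I}|\mathcal F(x_c\cdot e^{\mathrm j\phi_d})|^2}\in\mathbb R_+^{n\times n}$. Definition (prox-regularity). A set $\Omega$ is prox-regular at a point $\hat x\in\Omega$ if its projector $P_\Omega$ is single-valued around $\hat x$, i.e. on some neighborhood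 of $\hat x$. *)

theory Defs
  imports "HOL-Analysis.Analysis"
begin

datatype channel = XX | XY | XZ | YX | YY | YZ

lemma UNIV_channel: "UNIV = {XX, XY, XZ, YX, YY, YZ}"
  using channel.exhaust by auto

instance channel :: finite
  by standard (simp add: UNIV_channel)

text \<open>
  An \<open>n \<times> n\<close> array is an element of \<open>'a ^ 'n ^ 'n\<close> with \<open>n = CARD('n)\<close>. The linear order on
  \<open>'n\<close> serves only to number the indices: \<open>idx\<close> maps \<open>'n\<close> monotonically onto \<open>{1..n}\<close>.
  The norm of \<open>hspace\<close> is the Frobenius norm, see \<open>norm_hspace\<close>.
\<close>

type_synonym ('a, 'n) arr = "'a ^ 'n ^ 'n"
type_synonym 'n hspace = "(complex, 'n) arr ^ channel"

definition idx :: "'n::{finite,linorder} \<Rightarrow> nat" where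
  "idx i = card {k. k \<le> i}"

lemma bij_betw_idx: "bij_betw (idx :: 'n::{finite,linorder} \<Rightarrow> nat) UNIV {1..CARD('n)}"
proof -
  have less: "idx i < idx j" if "i < j" for i j :: 'n
  proof -
    have "j \<in> {k. k \<le> j} - {k. k \<le> i}" "{k. k \<le> i} \<subseteq> {k. k \<le> j}"
      using that by auto
    then show ?thesis
      unfolding idx_def by (intro psubset_card_mono) (simp, blast)
  qed
  have inj: "inj (idx :: 'n \<Rightarrow> nat)"
    by (rule injI) (metis less less_irrefl linorder_neqE)
  have "idx i \<in> {1..CARD('n)}" for i :: 'n
    unfolding idx_def by (auto simp: Suc_le_eq card_gt_0_iff intro: card_mono)
  then have "range (idx :: 'n \<Rightarrow> nat) \<subseteq> {1..CARD('n)}"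
    by auto
  then have "range (idx :: 'n \<Rightarrow> nat) = {1..CARD('n)}"
    by (rule card_subset_eq[OF finite_atLeastAtMost]) (simp add: card_image[OF inj])
  with inj show ?thesis
    by (simp add: bij_betw_def)
qed

lemma norm_hspace:
  fixes x :: "'n::finite hspace"
  shows "(norm x)\<^sup>2 = (\<Sum>c\<in>UNIV. \<Sum>a\<in>UNIV. \<Sum>b\<in>UNIV. (cmod (x $ c $ a $ b))\<^sup>2)"
  by (simp add: norm_vec_def L2_set_def sum_nonneg)

text \<open>Unitary normalisation; with numbering from 1 the exponents involve \<open>idx - 1\<close>.\<close>

definition dft2 :: "(complex, 'n::{finite,linorder}) arr \<Rightarrow> (complex, 'n) arr" where
  "dft2 w = (\<chi> a b. (\<Sum>p\<in>UNIV. \<Sum>q\<in>UNIV. w $ p $ q *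
      exp (- (2 * of_real pi * \<i> *
        of_nat ((idx a - 1) * (idx p - 1) + (idx b - 1) * (idx q - 1)) / of_nat CARD('n))))
      / of_nat CARD('n))"

definition phase_mult ::
    "(real, 'n::finite) arr \<Rightarrow> (complex, 'n) arr \<Rightarrow> (complex, 'n) arr" where
  "phase_mult \<phi> w = (\<chi> a b. w $ a $ b * exp (\<i> * of_real (\<phi> $ a $ b)))"

definition intensity :: "(real, 'n::{finite,linorder}) arr \<Rightarrow> 'n hspace \<Rightarrow> (real, 'n) arr" where
  "intensity \<phi> x = (\<chi> a b. \<Sum>c\<in>UNIV. (cmod (dft2 (phase_mult \<phi> (x $ c)) $ a $ b))\<^sup>2)"

definition amplitude :: "(real, 'n::{finite,linorder}) arr \<Rightarrow> 'n hspace \<Rightarrow> (real, 'n) arr" where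
  "amplitude \<phi> x = (\<chi> a b. sqrt (intensity \<phi> x $ a $ b))"

definition Omega :: "(real, 'n::{finite,linorder}) arr \<Rightarrow> (real, 'n) arr \<Rightarrow> 'n hspace set" where
  "Omega \<phi> r = {x. intensity \<phi> x = r}"

definition projector :: "'a::real_normed_vector set \<Rightarrow> 'a \<Rightarrow> 'a set" where
  "projector \<Omega> x = {w \<in> \<Omega>. norm (x - w) = (INF v\<in>\<Omega>. norm (x - v))}"

text \<open>Single-valued is read as: exactly one value, in particular the projection is nonempty.\<close>

definition prox_regular_at :: "'a::real_normed_vector set \<Rightarrow> 'a \<Rightarrow> bool" where
  "prox_regular_at \<Omega> x \<longleftrightarrow>
     x \<in> \<Omega> \<and> (\<exists>U. open U \<and> x \<in> U \<and> (\<forall>y\<in>U. is_singleton (projector \<Omega> y)))"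

end

theory Submission
  imports Defs
begin

text \<open>
  Multiplication by the unimodular factors \<open>e\<^sup>j\<^sup>\<phi>\<close> and the discrete Fourier transform are
  both unitary, so the channelwise measurement map \<open>measure_field\<close> is a linear isometry of the
  whole space (\<open>norm_measure_field\<close>, \<open>surj_measure_field\<close>), and such a map carries metric
  projections to metric projections. In the transformed coordinates the constraint decouples: at
  each pixel the vector of the six channel values has to lie on a sphere about the origin of
  \<open>\<complex>\<^sup>6\<close>.

  A point other than the centre of a sphere has exactly one nearest point on it, the radial one
  (\<open>sphere_unique_nearest\<close>). Since the squared distance is the sum of the squared pixel
  distances, a field that vanishes (over all channels) at no pixel has exactly one nearest point
  in the product of spheres (\<open>product_of_spheres_nearest\<close>). Fields without vanishing
  pixels form an open set, and this is the neighbourhood on which the projector is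
  single-valued.
\<close>

section \<open>Unitarity of the discrete Fourier transform\<close>

definition dft_root :: "'n::{finite,linorder} \<Rightarrow> complex" where
  "dft_root p = exp (2 * of_real pi * \<i> * of_nat (idx p - 1) / of_nat CARD('n))"

definition dft_kernel :: "'n::{finite,linorder} \<Rightarrow> 'n \<Rightarrow> complex" where
  "dft_kernel a p = inverse (dft_root p) ^ (idx a - 1)"

lemma idx_bounds: "idx (p :: 'n::{finite,linorder}) \<in> {1..CARD('n)}"
  using bij_betw_idx[where 'n='n] by (auto simp: bij_betw_def)

lemma dft_kernel_exp:
  "dft_kernel (a :: 'n::{finite,linorder}) p
     = exp (- (2 * of_real pi * \<i> * of_nat ((idx a - 1) * (idx p - 1)) / of_nat CARD('n)))"
  unfolding dft_kernel_def dft_root_def exp_minus[symmetric] exp_of_nat_mult[symmetric] of_nat_mult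
  by (simp only: mult_minus_right times_divide_eq_right mult_ac)

lemma dft2_separable:
  "dft2 (w :: (complex, 'n::{finite,linorder}) arr) $ a $ b
     = (\<Sum>q\<in>UNIV. (\<Sum>p\<in>UNIV. w $ p $ q * dft_kernel a p) * dft_kernel b q) / of_nat CARD('n)"
proof -
  have "exp (- (2 * of_real pi * \<i> *
        of_nat ((idx a - 1) * (idx p - 1) + (idx b - 1) * (idx q - 1)) / of_nat CARD('n)))
      = dft_kernel a p * dft_kernel b q" for p q :: 'n
    unfolding dft_kernel_exp exp_add[symmetric] of_nat_add
    by (simp only: distrib_left add_divide_distrib minus_add_distrib)
  then have "dft2 w $ a $ b
      = (\<Sum>p\<in>UNIV. \<Sum>q\<in>UNIV. w $ p $ q * dft_kernel a p * dft_kernel b q) / of_nat CARD('n)"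
    by (simp add: dft2_def mult.assoc)
  also have "\<dots> = (\<Sum>q\<in>UNIV. \<Sum>p\<in>UNIV. w $ p $ q * dft_kernel a p * dft_kernel b q)
      / of_nat CARD('n)"
    by (subst sum.swap) (rule refl)
  finally show ?thesis
    by (simp add: sum_distrib_right)
qed

lemma norm_dft_root [simp]: "cmod (dft_root p) = 1"
  by (simp add: dft_root_def)

lemma inj_dft_root: "inj (dft_root :: 'n::{finite,linorder} \<Rightarrow> complex)"
proof (rule injI)
  fix p q :: 'n
  assume "dft_root p = dft_root q"
  then have "(idx p - 1) mod CARD('n) = (idx q - 1) mod CARD('n)"
    unfolding dft_root_def by (subst (asm) complex_root_unity_eq) (auto simp: cong_def)
  then have "idx p = idx q"
    using idx_bounds[of p] idx_bounds[of q] by auto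
  then show "p = q"
    using bij_betw_idx[where 'n='n] by (auto simp: bij_betw_def inj_on_def)
qed

text \<open>
  Summing the kernel product over the output index gives a geometric series whose ratio is a root
  of unity of order dividing \<open>n\<close>; it equals \<open>1\<close> only on the diagonal.
\<close>
lemma dft_kernel_orthogonal:
  "(\<Sum>a\<in>UNIV. dft_kernel a p * cnj (dft_kernel a q))
     = (if p = (q :: 'n::{finite,linorder}) then of_nat CARD('n) else 0)"
proof -
  define z where "z = dft_root q / dft_root p"
  have "dft_root q * cnj (dft_root q) = 1"
    by (simp only: complex_norm_square[symmetric] norm_dft_root) simp
  then have cnj_inv: "cnj (inverse (dft_root q)) = dft_root q"
    by (simp add: inverse_unique)
  have "dft_kernel a p * cnj (dft_kernel a q) = z ^ (idx a - 1)" for a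
    by (simp only: dft_kernel_def complex_cnj_power cnj_inv z_def power_mult_distrib[symmetric])
       (simp add: field_simps)
  then have "(\<Sum>a\<in>UNIV. dft_kernel a p * cnj (dft_kernel a q)) = (\<Sum>a\<in>UNIV. z ^ (idx (a::'n) - 1))"
    by simp
  also have "\<dots> = (\<Sum>k\<in>{1..CARD('n)}. z ^ (k - 1))"
    by (rule sum.reindex_bij_betw[OF bij_betw_idx])
  also have "\<dots> = (\<Sum>k<CARD('n). z ^ k)"
    by (rule sum.reindex_bij_witness[of _ Suc "\<lambda>k. k - 1"]) auto
  also have "\<dots> = (if p = q then of_nat CARD('n) else 0)"
  proof (cases "p = q")
    case True
    moreover have "dft_root q \<noteq> 0"
      by (simp add: dft_root_def)
    ultimately show ?thesis
      by (simp add: z_def)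
  next
    case False
    then have "z \<noteq> 1"
      using inj_dft_root by (auto simp: z_def inj_def)
    moreover have "dft_root x ^ CARD('n) = 1" for x :: 'n
      unfolding dft_root_def by (rule complex_root_unity) simp
    then have "z ^ CARD('n) = 1"
      by (simp add: z_def power_divide)
    ultimately show ?thesis
      using False by (simp add: geometric_sum)
  qed
  finally show ?thesis .
qed

text \<open>
  Expanding the squares produces pairs of indices, of which orthogonality keeps the diagonal ones.
  The kernel carries no normalisation, hence the factor \<open>n\<close>; the two variables of \<open>dft2\<close> together
  give \<open>n\<^sup>2\<close>, which its prefactor \<open>1 / n\<close> cancels.
\<close>
lemma parseval_1d:
  fixes f :: "'n::{finite,linorder} \<Rightarrow> complex"
  shows "(\<Sum>a\<in>UNIV. (cmod (\<Sum>p\<in>UNIV. f p * dft_kernel a p))\<^sup>2)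
    = real CARD('n) * (\<Sum>p\<in>UNIV. (cmod (f p))\<^sup>2)" (is "?L = ?R")
proof -
  have "complex_of_real ?L
      = (\<Sum>a\<in>UNIV. \<Sum>p\<in>UNIV. \<Sum>q\<in>UNIV.
          f p * cnj (f q) * (dft_kernel a p * cnj (dft_kernel a q)))"
    by (simp only: of_real_sum complex_norm_square cnj_sum sum_product complex_cnj_mult mult_ac)
  also have "\<dots> = (\<Sum>p\<in>UNIV. \<Sum>a\<in>UNIV. \<Sum>q\<in>UNIV.
          f p * cnj (f q) * (dft_kernel a p * cnj (dft_kernel a q)))"
    by (rule sum.swap)
  also have "\<dots> = (\<Sum>p\<in>UNIV. \<Sum>q\<in>UNIV. \<Sum>a\<in>UNIV.
          f p * cnj (f q) * (dft_kernel a p * cnj (dft_kernel a q)))"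
    by (intro sum.cong refl sum.swap)
  also have "\<dots> = (\<Sum>p\<in>UNIV. \<Sum>q\<in>UNIV.
          f p * cnj (f q) * (if p = q then of_nat CARD('n) else 0))"
    by (simp only: sum_distrib_left[symmetric] dft_kernel_orthogonal)
  also have "\<dots> = (\<Sum>p\<in>UNIV. f p * cnj (f p) * of_nat CARD('n))"
    by (simp add: if_distrib[of "\<lambda>t. _ * t"] cong: if_cong)
  also have "\<dots> = complex_of_real ?R"
    by (simp only: of_real_mult of_real_sum complex_norm_square sum_distrib_left
        of_real_of_nat_eq mult_ac)
  finally show ?thesis
    by (simp only: of_real_eq_iff)
qed

text \<open>The kernel is a product of two one-dimensional ones, so Parseval applies in each variable.\<close>
lemma parseval_dft2:
  fixes w :: "(complex, 'n::{finite,linorder}) arr"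
  shows "(\<Sum>a\<in>UNIV. \<Sum>b\<in>UNIV. (cmod (dft2 w $ a $ b))\<^sup>2)
    = (\<Sum>a\<in>UNIV. \<Sum>b\<in>UNIV. (cmod (w $ a $ b))\<^sup>2)"
proof -
  let ?n = "real CARD('n)"
  have "(\<Sum>a\<in>UNIV. \<Sum>b\<in>UNIV. (cmod (dft2 w $ a $ b))\<^sup>2)
      = (\<Sum>a\<in>UNIV. \<Sum>b\<in>UNIV.
          (cmod (\<Sum>q\<in>UNIV. (\<Sum>p\<in>UNIV. w $ p $ q * dft_kernel a p) * dft_kernel b q))\<^sup>2) / ?n\<^sup>2"
    by (simp only: dft2_separable norm_divide power_divide sum_divide_distrib[symmetric] norm_of_nat)
  also have "\<dots> = (\<Sum>a\<in>UNIV. ?n *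
          (\<Sum>q\<in>UNIV. (cmod (\<Sum>p\<in>UNIV. w $ p $ q * dft_kernel a p))\<^sup>2)) / ?n\<^sup>2"
    by (simp only: parseval_1d)
  also have "\<dots> = ?n *
      (\<Sum>q\<in>UNIV. \<Sum>a\<in>UNIV. (cmod (\<Sum>p\<in>UNIV. w $ p $ q * dft_kernel a p))\<^sup>2) / ?n\<^sup>2"
    by (subst sum.swap) (simp only: sum_distrib_left)
  also have "\<dots> = ?n * (?n * (\<Sum>q\<in>UNIV. \<Sum>p\<in>UNIV. (cmod (w $ p $ q))\<^sup>2)) / ?n\<^sup>2"
    by (simp only: parseval_1d sum_distrib_left)
  also have "\<dots> = (\<Sum>q\<in>UNIV. \<Sum>p\<in>UNIV. (cmod (w $ p $ q))\<^sup>2)"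
    by (simp add: power2_eq_square)
  also have "\<dots> = (\<Sum>p\<in>UNIV. \<Sum>q\<in>UNIV. (cmod (w $ p $ q))\<^sup>2)"
    by (rule sum.swap)
  finally show ?thesis .
qed

section \<open>The measurement map as a linear isometry\<close>

definition measure_field ::
    "(real, 'n::{finite,linorder}) arr \<Rightarrow> 'n hspace \<Rightarrow> 'n hspace" where
  "measure_field \<phi> x = (\<chi> c. dft2 (phase_mult \<phi> (x $ c)))"

lemma linear_measure_field: "linear (measure_field \<phi>)"
proof (rule linearI)
  show "measure_field \<phi> (x + y) = measure_field \<phi> x + measure_field \<phi> y" for x y
    by (simp add: measure_field_def vec_eq_iff dft2_def phase_mult_def distrib_right sum.distrib
        add_divide_distrib)
  show "measure_field \<phi> (k *\<^sub>R x) = k *\<^sub>R measure_field \<phi> x" for k x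
    by (simp add: measure_field_def vec_eq_iff dft2_def phase_mult_def)
      (simp add: scaleR_conv_of_real sum_distrib_left mult_ac)
qed

lemma norm_measure_field: "norm (measure_field \<phi> x) = norm x"
proof -
  have "(norm (measure_field \<phi> x))\<^sup>2 = (norm x)\<^sup>2"
    unfolding norm_hspace
    by (simp add: measure_field_def parseval_dft2 phase_mult_def norm_mult)
  then show ?thesis
    by simp
qed

lemma inj_measure_field: "inj (measure_field \<phi>)"
  unfolding linear_injective_0[OF linear_measure_field]
  by (metis norm_eq_zero norm_measure_field)

lemma surj_measure_field: "surj (measure_field \<phi>)"
  using linear_injective_imp_surjective[OF linear_measure_field inj_measure_field] by auto

section \<open>Projection onto a product of spheres\<close>

lemma sphere_unique_nearest:
  fixes y w :: "'a::real_inner"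
  assumes "y \<noteq> 0" and "w \<noteq> norm w *\<^sub>R sgn y"
  shows "norm (y - norm w *\<^sub>R sgn y) < norm (y - w)"
proof -
  \<comment> \<open>All points of the sphere have the same norm, so only the inner product with \<open>y\<close>
      matters, and it is maximal exactly in the equality case of Cauchy-Schwarz.\<close>
  have "norm y *\<^sub>R w \<noteq> norm w *\<^sub>R y"
  proof
    assume "norm y *\<^sub>R w = norm w *\<^sub>R y"
    then have "inverse (norm y) *\<^sub>R norm y *\<^sub>R w = inverse (norm y) *\<^sub>R norm w *\<^sub>R y"
      by simp
    with assms show False
      by (simp add: sgn_div_norm mult.commute)
  qed
  then have "inner y w < norm y * norm w"
    using norm_cauchy_schwarz[of y w] norm_cauchy_schwarz_eq[of y w] by linarith
  moreover have "inner y (norm w *\<^sub>R sgn y) = norm y * norm w"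
    using assms(1) by (simp add: sgn_div_norm power2_norm_eq_inner[symmetric] power2_eq_square)
  moreover have "norm (norm w *\<^sub>R sgn y) = norm w"
    using assms(1) by (simp add: norm_sgn)
  moreover have "(norm (y - v))\<^sup>2 = (norm y)\<^sup>2 + (norm v)\<^sup>2 - 2 * inner y v" for v
    by (simp add: power2_norm_eq_inner inner_diff_left inner_diff_right inner_commute)
  ultimately have "(norm (y - norm w *\<^sub>R sgn y))\<^sup>2 < (norm (y - w))\<^sup>2"
    by (simp only:)
  then show ?thesis
    by (rule power2_less_imp_less) simp
qed

definition pixel :: "'n::finite hspace \<Rightarrow> 'n \<times> 'n \<Rightarrow> complex ^ channel" where
  "pixel u i = (\<chi> c. u $ c $ fst i $ snd i)"

definition of_pixels :: "('n::finite \<times> 'n \<Rightarrow> complex ^ channel) \<Rightarrow> 'n hspace" where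
  "of_pixels v = (\<chi> c a b. v (a, b) $ c)"

lemma pixel_of_pixels [simp]: "pixel (of_pixels v) i = v i"
  by (simp add: pixel_def of_pixels_def vec_eq_iff)

lemma pixel_diff: "pixel (u - v) i = pixel u i - pixel v i"
  by (simp add: pixel_def vec_eq_iff)

lemma pixel_eqI:
  assumes "\<And>i. pixel u i = pixel v i"
  shows "u = v"
proof -
  have "u $ c $ a $ b = v $ c $ a $ b" for c a b
    using assms[of "(a, b)"] by (simp add: pixel_def vec_eq_iff)
  then show ?thesis
    by (simp add: vec_eq_iff)
qed

lemma norm_pixel: "(norm (pixel u i))\<^sup>2 = (\<Sum>c\<in>UNIV. (cmod (u $ c $ fst i $ snd i))\<^sup>2)"
  by (simp add: pixel_def norm_vec_def L2_set_def sum_nonneg)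

lemma norm_hspace_pixels: "(norm u)\<^sup>2 = (\<Sum>i\<in>UNIV. (norm (pixel u i))\<^sup>2)"
proof -
  have "(norm u)\<^sup>2 = (\<Sum>c\<in>UNIV. \<Sum>i\<in>UNIV \<times> UNIV. (cmod (u $ c $ fst i $ snd i))\<^sup>2)"
    by (simp add: norm_hspace sum.cartesian_product case_prod_beta)
  also have "\<dots> = (\<Sum>i\<in>UNIV \<times> UNIV. \<Sum>c\<in>UNIV. (cmod (u $ c $ fst i $ snd i))\<^sup>2)"
    by (rule sum.swap)
  finally show ?thesis
    by (simp add: norm_pixel)
qed

text \<open>
  Each pixel contributes its own summand to the squared distance, hence minimisation over the
  product of spheres can be done pixel by pixel.
\<close>
lemma product_of_spheres_nearest:
  assumes "\<And>i. pixel y i \<noteq> 0" and "\<And>i. norm (pixel w i) = \<rho> i"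
    and "w \<noteq> of_pixels (\<lambda>i. \<rho> i *\<^sub>R sgn (pixel y i))" (is "w \<noteq> ?p")
  shows "norm (y - ?p) < norm (y - w)"
proof -
  have lt: "norm (pixel (y - ?p) i) < norm (pixel (y - w) i)" if "pixel w i \<noteq> pixel ?p i" for i
    using sphere_unique_nearest[of "pixel y i" "pixel w i"] that assms(1,2)
    by (simp add: pixel_diff)
  then have le: "norm (pixel (y - ?p) i) \<le> norm (pixel (y - w) i)" for i
    by (cases "pixel w i = pixel ?p i") (auto simp: pixel_diff less_imp_le)
  obtain i where "pixel w i \<noteq> pixel ?p i"
    using assms(3) pixel_eqI by blast
  then have "(\<Sum>i\<in>UNIV. (norm (pixel (y - ?p) i))\<^sup>2) < (\<Sum>i\<in>UNIV. (norm (pixel (y - w) i))\<^sup>2)"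
    by (intro sum_strict_mono_ex1 ballI bexI[of _ i] power_mono power_strict_mono le lt) auto
  then have "(norm (y - ?p))\<^sup>2 < (norm (y - w))\<^sup>2"
    by (simp only: norm_hspace_pixels)
  then show ?thesis
    by (rule power2_less_imp_less) simp
qed

section \<open>Prox-regularity\<close>

lemma projector_eq_singleton:
  assumes "p \<in> \<Omega>" and "\<And>w. w \<in> \<Omega> \<Longrightarrow> w \<noteq> p \<Longrightarrow> norm (y - p) < norm (y - w)"
  shows "projector \<Omega> y = {p}"
proof -
  have "(INF v\<in>\<Omega>. norm (y - v)) = norm (y - p)"
    by (rule cInf_eq_minimum) (use assms in \<open>auto simp: less_imp_le intro: le_less[THEN iffD2]\<close>)
  then show ?thesis
    using assms by (force simp: projector_def)
qed

lemma intensity_eq_pixel: "intensity \<phi> x $ a $ b = (norm (pixel (measure_field \<phi> x) (a, b)))\<^sup>2"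
  by (simp add: intensity_def measure_field_def norm_pixel)

lemma mem_Omega_iff:
  assumes "\<And>a b. r $ a $ b \<ge> 0"
  shows "x \<in> Omega \<phi> r
    \<longleftrightarrow> (\<forall>i. norm (pixel (measure_field \<phi> x) i) = sqrt (r $ fst i $ snd i))"
proof -
  have "x \<in> Omega \<phi> r
      \<longleftrightarrow> (\<forall>a b. (norm (pixel (measure_field \<phi> x) (a, b)))\<^sup>2 = r $ a $ b)"
    by (simp add: Omega_def vec_eq_iff intensity_eq_pixel)
  also have "\<dots> \<longleftrightarrow> (\<forall>a b. norm (pixel (measure_field \<phi> x) (a, b)) = sqrt (r $ a $ b))"
    using assms by (metis norm_ge_zero real_sqrt_pow2 real_sqrt_unique)
  finally show ?thesis
    by simp
qed

text \<open>
  The isometry turns distances to \<open>Omega\<close> into distances to a product of spheres. Its surjectivity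
  is what brings the nearest point of that product back into \<open>Omega\<close>, its injectivity what makes
  the preimage unique.
\<close>
lemma projector_Omega_singleton:
  assumes "\<And>a b. r $ a $ b \<ge> 0" and "\<And>i. pixel (measure_field \<phi> y) i \<noteq> 0"
  shows "is_singleton (projector (Omega \<phi> r) y)"
proof -
  let ?T = "measure_field \<phi>"
  let ?P = "of_pixels (\<lambda>i. sqrt (r $ fst i $ snd i) *\<^sub>R sgn (pixel (?T y) i))"
  obtain p where p: "?T p = ?P"
    using surjD[OF surj_measure_field[of \<phi>], of ?P] by auto
  have dist: "norm (y - w) = norm (?T y - ?T w)" for w
    by (simp add: linear_diff[OF linear_measure_field, symmetric] norm_measure_field)
  have "projector (Omega \<phi> r) y = {p}"
  proof (rule projector_eq_singleton)
    show "p \<in> Omega \<phi> r"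
      using assms by (simp add: mem_Omega_iff p norm_sgn)
    fix w assume "w \<in> Omega \<phi> r" "w \<noteq> p"
    moreover from \<open>w \<noteq> p\<close> have "?T w \<noteq> ?P"
      using injD[OF inj_measure_field] p by metis
    ultimately show "norm (y - p) < norm (y - w)"
      unfolding dist p using assms
      by (intro product_of_spheres_nearest) (auto simp: mem_Omega_iff)
  qed
  then show ?thesis
    by simp
qed

lemma open_nonvanishing_pixels: "open {y. \<forall>i. pixel (measure_field \<phi> y) i \<noteq> 0}"
proof -
  have "continuous_on UNIV (measure_field \<phi>)"
    by (rule linear_continuous_on)
      (simp add: linear_conv_bounded_linear[symmetric] linear_measure_field)
  then have "continuous_on UNIV (\<lambda>y. pixel (measure_field \<phi> y) i)" for i
    unfolding pixel_def by (intro continuous_intros)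
  then have "open {y. pixel (measure_field \<phi> y) i \<noteq> 0}" for i
    by (intro open_Collect_neq continuous_intros)
  then have "open (\<Inter>i. {y. pixel (measure_field \<phi> y) i \<noteq> 0})"
    by (intro open_INT) auto
  then show ?thesis
    by (simp only: Collect_all_eq)
qed

theorem proposition5p5:
  fixes m :: nat
    and \<phi> r :: "nat \<Rightarrow> (real, 'n::{finite,linorder}) arr"
  assumes "m \<ge> 1"
    and "\<And>d a b. d \<in> {1..m} \<Longrightarrow> r d $ a $ b \<ge> 0"
  shows "\<forall>d\<in>{1..m}. \<forall>x\<in>Omega (\<phi> d) (r d).
           (\<forall>a b. amplitude (\<phi> d) x $ a $ b \<noteq> 0) \<longrightarrow> prox_regular_at (Omega (\<phi> d) (r d)) x"
proof (intro ballI impI)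
  fix d x
  assume d: "d \<in> {1..m}" and x: "x \<in> Omega (\<phi> d) (r d)"
    and nz: "\<forall>a b. amplitude (\<phi> d) x $ a $ b \<noteq> 0"
  let ?U = "{y. \<forall>i. pixel (measure_field (\<phi> d) y) i \<noteq> 0}"
  have "x \<in> ?U"
    using nz by (auto simp: amplitude_def intensity_eq_pixel)
  moreover have "is_singleton (projector (Omega (\<phi> d) (r d)) y)" if "y \<in> ?U" for y
    using that assms(2)[OF d] by (intro projector_Omega_singleton) auto
  ultimately show "prox_regular_at (Omega (\<phi> d) (r d)) x"
    unfolding prox_regular_at_def using x open_nonvanishing_pixels[of "\<phi> d"] by blast
qed

end
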